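(* Let $n\ge2$ and $t\ge1$ be integers, and let $X$ be a spherical design of harmonic index $t$ on $S^{n-1}$. Put $$c_{n,t}=-\min_{-1\le x\le 1}Q_{n,t}(x).$$ Then $$|X|\ \ge\ 1+\frac{1}{c_{n,t}}\left\{\binom{n+t-1}{t}-\binom{n+t-3}{t-2}\right\}.$$ Moreover, equality holds if and only if $c_{n,t}=-Q_{n,t}(a)$ for every $a\in I(X)$.
   Context: $S^{n-1}$ denotes the unit sphere centered at the origin in $\mathbb{R}^n$ and $\langle\cdot,\cdot\rangle$ the standard inner product. $\mathrm{Harm}_t(\mathbb{R}^n)$ is the space of real homogeneous polynomials $f$ of degree $t$ in $n$ variables with $\Delta f=0$, where $\Delta=\sum_i\partial^2/\partial x_i^2$. A finite nonempty subset $X\subset S^{n-1}$ is a spherical design of harmonic index $t$ if $\sum_{x\in X}f(x)=0$ for every $f\in\mathrm{Harm}_t(\mathbb{R}^n)$. For a finite subset $X$ of the sphere, $I(X)=\{\langle x,y\rangle\mid x,y\in X,\ x\neq y\}$. $Q_{n,t}$: let $C_t^\lambda(x)$ be the Gegenbauer polynomial of degree $t$, defined for $\lambda\ne0$ by $(1-2xr+r^2)^{-\lambda}=\sum_{t\ge0}C_t^\lambda(x)r^t$, and for $\lambda=0$ by the Chebyshev polynomial of the first kind $C_t^0(x)=\cos(t\arccos x)$. Then $Q_{n,t}(x)=A_{n,t}C_t^{(n-2)/2}(x)$, where the constant $A_{n,t}$ is chosen so that $Q_{n,t}(1)=\binom{n+t-1}{t}-\binom{n+t-3}{t-2}$ (a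 binomial coefficient with negative lower entry is $0$). The number $c_{n,t}$ is always positive. *)

theory Defs
  imports "HOL-Analysis.Analysis" "HOL-Computational_Algebra.Formal_Power_Series"
begin

section \<open>Harmonic homogeneous polynomials and designs of harmonic index\<close>

text \<open>Real polynomials in $n$ variables are identified with the polynomial functions on
  \<^typ>\<open>real ^ 'n\<close>; a multi-index is a function \<open>\<alpha> :: 'n \<Rightarrow> nat\<close>.\<close>

definition homogeneous_poly :: "nat \<Rightarrow> (real ^ 'n \<Rightarrow> real) \<Rightarrow> bool" where
  "homogeneous_poly t f \<longleftrightarrow>
     (\<exists>c :: ('n \<Rightarrow> nat) \<Rightarrow> real.
        \<forall>x. f x = (\<Sum>\<alpha> | (\<Sum>i\<in>UNIV. \<alpha> i) = t. c \<alpha> * (\<Prod>i\<in>UNIV. (x $ i) ^ \<alpha> i)))"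

lemma finite_multi_indices: "finite {\<alpha> :: 'n::finite \<Rightarrow> nat. (\<Sum>i\<in>UNIV. \<alpha> i) = t}"
proof (rule finite_subset)
  show "{\<alpha> :: 'n \<Rightarrow> nat. (\<Sum>i\<in>UNIV. \<alpha> i) = t} \<subseteq> UNIV \<rightarrow>\<^sub>E {..t}"
    by (auto simp: PiE_def extensional_def intro: member_le_sum)
  show "finite ((UNIV :: 'n set) \<rightarrow>\<^sub>E {..t})"
    by (intro finite_PiE) auto
qed

definition partial_deriv :: "'n \<Rightarrow> (real ^ 'n \<Rightarrow> real) \<Rightarrow> real ^ 'n \<Rightarrow> real" where
  "partial_deriv i f x = deriv (\<lambda>s. f (x + s *\<^sub>R axis i 1)) 0"

definition laplacian :: "(real ^ 'n \<Rightarrow> real) \<Rightarrow> real ^ 'n \<Rightarrow> real" where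
  "laplacian f x = (\<Sum>i\<in>UNIV. partial_deriv i (partial_deriv i f) x)"

definition Harm :: "nat \<Rightarrow> (real ^ 'n \<Rightarrow> real) set" where
  "Harm t = {f. homogeneous_poly t f \<and> (\<forall>x. laplacian f x = 0)}"

definition harmonic_index_design :: "nat \<Rightarrow> (real ^ 'n) set \<Rightarrow> bool" where
  "harmonic_index_design t X \<longleftrightarrow>
     finite X \<and> X \<noteq> {} \<and> X \<subseteq> sphere 0 1 \<and> (\<forall>f\<in>Harm t. (\<Sum>x\<in>X. f x) = 0)"

definition inner_set :: "(real ^ 'n) set \<Rightarrow> real set" where
  "inner_set X = {x \<bullet> y | x y. x \<in> X \<and> y \<in> X \<and> x \<noteq> y}"


section \<open>Gegenbauer polynomials\<close>

text \<open>For $\mu \neq 0$, \<open>gegenbauer \<mu> t x\<close> is the coefficient of $r^t$ in the formal power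
  series $(1 - 2xr + r^2)^{-\mu}$, written as the binomial series $(1 + u)^{-\mu}$ with
  $u = r^2 - 2xr$ substituted. For $\mu = 0$ it is the Chebyshev polynomial of the first kind,
  given by a formula that is meaningful only for $-1 \le x \le 1$; all uses below are in
  that range.\<close>

definition gegenbauer :: "real \<Rightarrow> nat \<Rightarrow> real \<Rightarrow> real" where
  "gegenbauer \<mu> t x =
     (if \<mu> = 0 then cos (real t * arccos x)
      else fps_nth (fps_binomial (- \<mu>) oo (fps_X ^ 2 - fps_const (2 * x) * fps_X)) t)"

text \<open>The number $\binom{n+t-1}{t} - \binom{n+t-3}{t-2}$. The case distinction implements the
  convention that a binomial coefficient with negative lower entry is $0$; truncated
  subtraction on \<^typ>\<open>nat\<close> would otherwise turn it into $\binom{n+t-3}{0} = 1$ for $t = 1$.\<close>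

definition harm_dim :: "nat \<Rightarrow> nat \<Rightarrow> real" where
  "harm_dim n t =
     real ((n + t - 1) choose t) - (if t < 2 then 0 else real ((n + t - 3) choose (t - 2)))"

text \<open>The factor in front is the normalising constant $A_{n,t}$; see \<open>Q_at_1\<close> below.\<close>

definition Q :: "nat \<Rightarrow> nat \<Rightarrow> real \<Rightarrow> real" where
  "Q n t x =
     (harm_dim n t / gegenbauer ((real n - 2) / 2) t 1) * gegenbauer ((real n - 2) / 2) t x"

text \<open>The least element is the minimum of \<^term>\<open>Q n t\<close> on $[-1,1]$, which exists by
  \<open>Q_attains_min\<close> below.\<close>

definition c_const :: "nat \<Rightarrow> nat \<Rightarrow> real" where
  "c_const n t = - (LEAST y. y \<in> Q n t ` {-1..1})"


section \<open>Well-definedness of the normalisation and of the minimum\<close>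

lemma fps_binomial_compose_square:
  fixes a :: real
  shows "fps_binomial a oo (fps_X ^ 2 + 2 * fps_X) = fps_binomial (2 * a)"
proof -
  let ?u = "fps_X ^ 2 + 2 * fps_X :: real fps"
  let ?F = "fps_binomial a oo ?u"
  have u0: "fps_nth ?u 0 = 0" by simp
  have unit: "fps_nth (1 + fps_X :: real fps) 0 \<noteq> 0" by simp
  have nz: "(1 + fps_X :: real fps) \<noteq> 0" using unit by force
  have d: "fps_deriv (fps_binomial a) * (1 + fps_X) = fps_const a * fps_binomial a"
    unfolding fps_binomial_deriv using unit by (simp add: fps_divide_unit mult.assoc inverse_mult_eq_1)
  have "(fps_deriv (fps_binomial a) oo ?u) * ((1 + fps_X) oo ?u) = (fps_const a oo ?u) * ?F"
    using arg_cong[OF d, of "\<lambda>f. f oo ?u"] by (simp only: fps_compose_mult_distrib[OF u0])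
  moreover have "(1 + fps_X) oo ?u = (1 + fps_X) ^ 2"
    by (simp add: fps_compose_add_distrib u0 power2_eq_square algebra_simps)
  ultimately have e: "(fps_deriv (fps_binomial a) oo ?u) * (1 + fps_X) ^ 2 = fps_const a * ?F"
    by simp
  have du: "fps_deriv ?u = 2 * (1 + fps_X)"
    by (simp add: power2_eq_square algebra_simps)
  have "fps_deriv ?F = (fps_deriv (fps_binomial a) oo ?u) * (2 * (1 + fps_X))"
    using fps_compose_deriv[OF u0, of "fps_binomial a"] du by simp
  then have "fps_deriv ?F * (1 + fps_X) = 2 * ((fps_deriv (fps_binomial a) oo ?u) * (1 + fps_X) ^ 2)"
    by (simp add: power2_eq_square algebra_simps)
  also have "\<dots> = fps_const (2 * a) * ?F"
    unfolding e by (simp add: numeral_fps_const mult.assoc[symmetric])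
  finally have "fps_deriv ?F = fps_const (2 * a) * ?F / (1 + fps_X)"
    using nz by (metis nonzero_mult_div_cancel_right)
  then show ?thesis
    using fps_binomial_ODE_unique'[of ?F "2 * a"] by simp
qed

lemma gegenbauer_at_1_pos:
  assumes "l \<ge> 0"
  shows "gegenbauer l t 1 > 0"
proof (cases "l = 0")
  case False
  then have l: "l > 0" using assms by simp
  have m0: "fps_nth (- fps_X :: real fps) 0 = 0" by simp
  have u0: "fps_nth (fps_X ^ 2 + 2 * fps_X :: real fps) 0 = 0" by simp
  have eq: "fps_X ^ 2 - fps_const (2 * 1) * fps_X = (fps_X ^ 2 + 2 * fps_X) oo (- fps_X :: real fps)"
    by (simp add: fps_compose_add_distrib fps_compose_mult_distrib[OF m0] power2_eq_square
        numeral_fps_const)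
  have "fps_binomial (- l) oo (fps_X ^ 2 - fps_const (2 * 1) * fps_X)
      = fps_binomial (2 * - l) oo (- fps_X)"
    unfolding eq fps_compose_assoc[OF m0 u0] fps_binomial_compose_square ..
  then have "gegenbauer l t 1 = (-1) ^ t * ((2 * - l) gchoose t)"
    using False by (simp add: gegenbauer_def fps_compose_uminus')
  also have "\<dots> = pochhammer (2 * l) t / fact t"
    by (simp add: gbinomial_pochhammer mult.assoc[symmetric] flip: power_mult_distrib)
  finally show ?thesis using l by (simp add: pochhammer_pos)
qed (simp add: gegenbauer_def)

lemma Q_at_1:
  assumes "n \<ge> 2"
  shows "Q n t 1 = harm_dim n t"
  using gegenbauer_at_1_pos[of "(real n - 2) / 2" t] assms by (simp add: Q_def)

lemma continuous_on_gegenbauer: "continuous_on {-1..1} (gegenbauer l t)"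
proof (cases "l = 0")
  case True
  then show ?thesis
    unfolding gegenbauer_def by (auto intro!: continuous_intros)
next
  case False
  define u :: "real \<Rightarrow> real fps" where "u = (\<lambda>x. fps_X ^ 2 - fps_const (2 * x) * fps_X)"
  have u: "continuous_on {-1..1} (\<lambda>x. fps_nth (u x) k)" for k
    unfolding u_def by (cases k; cases "k = 1") (auto intro!: continuous_intros)
  have pow: "continuous_on {-1..1} (\<lambda>x. fps_nth (u x ^ i) k)" for i k
  proof (induction i arbitrary: k)
    case (Suc i)
    show ?case
      unfolding power_Suc fps_mult_nth by (intro continuous_on_sum continuous_on_mult u Suc.IH)
  qed simp
  have "continuous_on {-1..1} (\<lambda>x. \<Sum>i=0..t. fps_nth (fps_binomial (- l)) i * fps_nth (u x ^ i) t)"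
    by (intro continuous_on_sum continuous_on_mult continuous_on_const pow)
  moreover have "gegenbauer l t = (\<lambda>x. \<Sum>i=0..t. fps_nth (fps_binomial (- l)) i * fps_nth (u x ^ i) t)"
    using False by (auto simp: gegenbauer_def u_def fps_compose_nth)
  ultimately show ?thesis by simp
qed

lemma Q_attains_min: "\<exists>x\<in>{-1..1}. \<forall>y\<in>{-1..1}. Q n t x \<le> Q n t y"
proof (rule continuous_attains_inf)
  show "continuous_on {-1..1} (Q n t)"
    unfolding Q_def by (intro continuous_on_mult continuous_on_const continuous_on_gegenbauer)
qed auto

end

theory Submission
  imports Defs
begin

text \<open>For a unit vector \<open>y\<close>, the homogenised zonal function
  \<open>x \<mapsto> |x|\<^sup>t Q(\<langle>x, y\<rangle> / |x|)\<close> is a harmonic homogeneous polynomial of degree \<open>t\<close>, so it sums to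
  zero over a design \<open>X\<close>. Taking \<open>y \<in> X\<close> and summing over \<open>y\<close> gives
  \<open>|X| Q(1) + \<Sum>\<^sub>x\<^sub>\<noteq>\<^sub>y Q(\<langle>x, y\<rangle>) = 0\<close>. Each off-diagonal term is at least \<open>-c\<close>, which yields the bound,
  and equality means that every off-diagonal term equals \<open>-c\<close>. The positivity of \<open>c\<close> also
  drops out, since \<open>|X| (|X| - 1) c \<ge> |X| Q(1) > 0\<close>.\<close>

section \<open>Homogeneous polynomials\<close>

lemma homogeneous_poly_zero: "homogeneous_poly t (\<lambda>x. 0)"
  unfolding homogeneous_poly_def by (intro exI[of _ "\<lambda>_. 0"]) simp

lemma homogeneous_poly_add:
  assumes "homogeneous_poly t f" "homogeneous_poly t g"
  shows "homogeneous_poly t (\<lambda>x. f x + g x)"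
proof -
  obtain c d where
    "\<And>x. f x = (\<Sum>\<alpha> | (\<Sum>i\<in>UNIV. \<alpha> i) = t. c \<alpha> * (\<Prod>i\<in>UNIV. (x $ i) ^ \<alpha> i))"
    "\<And>x. g x = (\<Sum>\<alpha> | (\<Sum>i\<in>UNIV. \<alpha> i) = t. d \<alpha> * (\<Prod>i\<in>UNIV. (x $ i) ^ \<alpha> i))"
    using assms unfolding homogeneous_poly_def by blast
  then show ?thesis
    unfolding homogeneous_poly_def
    by (intro exI[of _ "\<lambda>\<alpha>. c \<alpha> + d \<alpha>"]) (simp add: sum.distrib distrib_right)
qed

lemma homogeneous_poly_cmult:
  assumes "homogeneous_poly t f"
  shows "homogeneous_poly t (\<lambda>x. k * f x)"
proof -
  obtain c where
    "\<And>x. f x = (\<Sum>\<alpha> | (\<Sum>i\<in>UNIV. \<alpha> i) = t. c \<alpha> * (\<Prod>i\<in>UNIV. (x $ i) ^ \<alpha> i))"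
    using assms unfolding homogeneous_poly_def by blast
  then show ?thesis
    unfolding homogeneous_poly_def
    by (intro exI[of _ "\<lambda>\<alpha>. k * c \<alpha>"]) (simp add: sum_distrib_left mult.assoc)
qed

lemma homogeneous_poly_sum:
  assumes "\<And>a. a \<in> A \<Longrightarrow> homogeneous_poly t (f a)"
  shows "homogeneous_poly t (\<lambda>x. \<Sum>a\<in>A. f a x)"
  using assms
  by (induction A rule: infinite_finite_induct)
     (simp_all add: homogeneous_poly_zero homogeneous_poly_add)

lemma homogeneous_poly_monomial:
  fixes \<alpha> :: "'n::finite \<Rightarrow> nat"
  assumes "(\<Sum>i\<in>UNIV. \<alpha> i) = t"
  shows "homogeneous_poly t (\<lambda>x. \<Prod>i\<in>UNIV. (x $ i) ^ \<alpha> i)"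
  unfolding homogeneous_poly_def
proof (intro exI[of _ "\<lambda>\<beta>. if \<beta> = \<alpha> then 1 else 0"] allI)
  fix x :: "real ^ 'n"
  have "(\<Sum>\<beta> | (\<Sum>i\<in>UNIV. \<beta> i) = t. (if \<beta> = \<alpha> then 1 else 0) * (\<Prod>i\<in>UNIV. (x $ i) ^ \<beta> i))
      = (\<Sum>\<beta> | (\<Sum>i\<in>UNIV. \<beta> i) = t. if \<beta> = \<alpha> then (\<Prod>i\<in>UNIV. (x $ i) ^ \<beta> i) else 0)"
    by (intro sum.cong) auto
  also have "\<dots> = (\<Prod>i\<in>UNIV. (x $ i) ^ \<alpha> i)"
    using assms by (simp add: sum.delta[OF finite_multi_indices])
  finally show "(\<Prod>i\<in>UNIV. (x $ i) ^ \<alpha> i) = (\<Sum>\<beta> | (\<Sum>i\<in>UNIV. \<beta> i) = t.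
      (if \<beta> = \<alpha> then 1 else 0) * (\<Prod>i\<in>UNIV. (x $ i) ^ \<beta> i))" ..
qed

text \<open>Multiplying out the two expansions, multi-indices add pointwise and hence so do total
  degrees.\<close>

lemma homogeneous_poly_mult:
  assumes "homogeneous_poly s f" "homogeneous_poly t g"
  shows "homogeneous_poly (s + t) (\<lambda>x. f x * g x)"
proof -
  obtain c d where
    "\<And>x. f x = (\<Sum>\<alpha> | (\<Sum>i\<in>UNIV. \<alpha> i) = s. c \<alpha> * (\<Prod>i\<in>UNIV. (x $ i) ^ \<alpha> i))"
    "\<And>x. g x = (\<Sum>\<beta> | (\<Sum>i\<in>UNIV. \<beta> i) = t. d \<beta> * (\<Prod>i\<in>UNIV. (x $ i) ^ \<beta> i))"
    using assms unfolding homogeneous_poly_def by blast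
  then have "(\<lambda>x. f x * g x) = (\<lambda>x. \<Sum>\<alpha> | (\<Sum>i\<in>UNIV. \<alpha> i) = s. \<Sum>\<beta> | (\<Sum>i\<in>UNIV. \<beta> i) = t.
      (c \<alpha> * d \<beta>) * (\<Prod>i\<in>UNIV. (x $ i) ^ (\<alpha> i + \<beta> i)))"
    by (simp add: sum_product power_add prod.distrib mult_ac)
  then show ?thesis
    by (auto intro!: homogeneous_poly_sum homogeneous_poly_cmult homogeneous_poly_monomial
        simp: sum.distrib)
qed

lemma homogeneous_poly_one: "homogeneous_poly 0 (\<lambda>x. 1)"
  using homogeneous_poly_monomial[of "\<lambda>_. 0" 0] by simp

lemma homogeneous_poly_power:
  assumes "homogeneous_poly s f"
  shows "homogeneous_poly (s * k) (\<lambda>x. f x ^ k)"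
proof (induction k)
  case (Suc k)
  then show ?case using homogeneous_poly_mult[OF assms Suc] by simp
qed (simp add: homogeneous_poly_one)

lemma homogeneous_poly_nth: "homogeneous_poly 1 (\<lambda>x :: real ^ 'n. x $ i)"
proof -
  have "(\<lambda>x :: real ^ 'n. \<Prod>j\<in>UNIV. (x $ j) ^ (if j = i then 1 else 0)) = (\<lambda>x. x $ i)"
    by (auto simp: if_distrib[of "\<lambda>k. _ ^ k"] cong: if_cong)
  moreover have "homogeneous_poly 1 (\<lambda>x :: real ^ 'n. \<Prod>j\<in>UNIV. (x $ j) ^ (if j = i then 1 else 0))"
    by (rule homogeneous_poly_monomial) simp
  ultimately show ?thesis by simp
qed

lemma homogeneous_poly_inner: "homogeneous_poly 1 (\<lambda>x. x \<bullet> y)"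
  unfolding inner_vec_def inner_real_def
  by (subst mult.commute) (intro homogeneous_poly_sum homogeneous_poly_cmult homogeneous_poly_nth)

lemma homogeneous_poly_inner_self: "homogeneous_poly 2 (\<lambda>x. x \<bullet> x)"
proof -
  have "homogeneous_poly (1 * 2) (\<lambda>x :: real ^ 'n. (x $ i) ^ 2)" for i
    by (intro homogeneous_poly_power homogeneous_poly_nth)
  then show ?thesis
    unfolding inner_vec_def inner_real_def
    by (intro homogeneous_poly_sum) (simp add: power2_eq_square)
qed


section \<open>Harmonicity of zonal polynomials\<close>

text \<open>The conclusion equates functions, not values, so it can rewrite the inner
  \<open>partial_deriv\<close> of \<open>laplacian\<close>.\<close>

lemma partial_deriv_eqI:
  assumes "\<And>x. ((\<lambda>s. f (x + s *\<^sub>R axis i 1)) has_real_derivative f' x) (at 0)"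
  shows "partial_deriv i f = f'"
  by (rule ext) (simp add: partial_deriv_def DERIV_imp_deriv[OF assms])

text \<open>This is the second differentiation of a power. For \<open>n < 2\<close> the real
  coefficient vanishes, so the truncated exponent \<open>n - 2\<close> does no harm.\<close>

lemma has_real_derivative_falling_power:
  assumes "(f has_real_derivative D) (at x)"
  shows "((\<lambda>s. real n * f s ^ (n - 1)) has_real_derivative
    real n * (real n - 1) * f x ^ (n - 2) * D) (at x)"
  by (cases n) (auto intro!: derivative_eq_intros assms simp: numeral_2_eq_2)

text \<open>With \<open>c = 0\<close>, \<open>v\<close> is \<open>|x|\<^sup>2\<close>; with \<open>c = 1\<close> it is the squared distance to the line through
  \<open>y\<close>. The former suits the generating function of the Gegenbauer polynomials, the
  latter the expansion of \<open>cos (t \<theta>)\<close> in \<open>cos \<theta>\<close> and \<open>sin\<^sup>2 \<theta>\<close>.\<close>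

lemma laplacian_zonal_sum:
  fixes y :: "real ^ 'n" and c :: real and J :: "nat set" and k :: "nat \<Rightarrow> nat"
  assumes y: "y \<bullet> y = 1" and c: "c * c = c"
  defines "p \<equiv> (\<lambda>x. x \<bullet> y)" and "v \<equiv> (\<lambda>x. x \<bullet> x - c * (x \<bullet> y)\<^sup>2)"
  shows "laplacian (\<lambda>x. \<Sum>j\<in>J. a j * (v x ^ j * p x ^ k j)) x =
    (\<Sum>j\<in>J. a j * (real j * (4 * (real j - 1) + 2 * (real CARD('n) - c) + 4 * real (k j) * (1 - c))
              * v x ^ (j - 1) * p x ^ k j
          + real (k j) * (real (k j) - 1) * v x ^ j * p x ^ (k j - 2)))"
proof -
  let ?e = "\<lambda>i. axis i 1 :: real ^ 'n"
  \<comment> \<open>\<open>?w i\<close> is the partial derivative of \<open>v\<close> in direction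
    \<open>i\<close>; \<open>?g i\<close> and \<open>?h i\<close> come from differentiating
    \<open>?f\<close> once and twice in that direction.\<close>
  let ?w = "\<lambda>i x. 2 * (x $ i - c * p x * y $ i)"
  let ?f = "\<lambda>x. \<Sum>j\<in>J. a j * (v x ^ j * p x ^ k j)"
  let ?g = "\<lambda>i x. \<Sum>j\<in>J. a j * (real j * v x ^ (j - 1) * ?w i x * p x ^ k j
      + v x ^ j * (real (k j) * p x ^ (k j - 1) * y $ i))"
  let ?h = "\<lambda>i x j. real j * (real j - 1) * v x ^ (j - 2) * (?w i x)\<^sup>2 * p x ^ k j
      + real j * v x ^ (j - 1) * (2 - 2 * c * (y $ i)\<^sup>2) * p x ^ k j
      + 2 * (real j * v x ^ (j - 1) * (real (k j) * p x ^ (k j - 1))) * (?w i x * y $ i)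
      + v x ^ j * (real (k j) * (real (k j) - 1) * p x ^ (k j - 2)) * (y $ i)\<^sup>2"
  have p: "((\<lambda>s. p (x + s *\<^sub>R ?e i)) has_real_derivative y $ i) (at 0)" for x i
    unfolding p_def inner_add_left inner_scaleR_left
    by (auto intro!: derivative_eq_intros simp: inner_axis')
  have x: "((\<lambda>s. (x + s *\<^sub>R ?e i) $ i) has_real_derivative 1) (at 0)" for x i
    by (auto intro!: derivative_eq_intros)
  have q: "((\<lambda>s. (x + s *\<^sub>R ?e i) \<bullet> (x + s *\<^sub>R ?e i)) has_real_derivative 2 * x $ i) (at 0)" for x i
    by (simp add: inner_add_left inner_add_right inner_axis inner_axis')
       (auto intro!: derivative_eq_intros)
  have v: "((\<lambda>s. v (x + s *\<^sub>R ?e i)) has_real_derivative ?w i x) (at 0)" for x i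
  proof -
    have "((\<lambda>s. (x + s *\<^sub>R ?e i) \<bullet> (x + s *\<^sub>R ?e i) - c * (p (x + s *\<^sub>R ?e i))\<^sup>2)
        has_real_derivative ?w i x) (at 0)"
      by (rule derivative_eq_intros p q refl | simp add: algebra_simps)+
    then show ?thesis by (simp add: v_def p_def)
  qed
  have first: "partial_deriv i ?f = ?g i" for i
    by (rule partial_deriv_eqI)
       (rule derivative_eq_intros p v refl | simp add: algebra_simps)+
  have second: "partial_deriv i (?g i) = (\<lambda>x. \<Sum>j\<in>J. a j * ?h i x j)" for i
  proof (rule partial_deriv_eqI)
    fix x
    have w: "((\<lambda>s. ?w i (x + s *\<^sub>R ?e i)) has_real_derivative 2 - 2 * c * (y $ i)\<^sup>2) (at 0)"
      by (rule derivative_eq_intros p x refl | simp add: algebra_simps power2_eq_square)+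
    have "((\<lambda>s. a j * (real j * v (x + s *\<^sub>R ?e i) ^ (j - 1) * ?w i (x + s *\<^sub>R ?e i) * p (x + s *\<^sub>R ?e i) ^ k j
      + v (x + s *\<^sub>R ?e i) ^ j * (real (k j) * p (x + s *\<^sub>R ?e i) ^ (k j - 1) * y $ i)))
       has_real_derivative a j * ?h i x j) (at 0)" for j
    proof -
      note v = v[of x i] and p = p[of x i]
      \<comment> \<open>The derivative is assembled along the term structure of \<open>?g\<close>,
        so that its powers come out with the coefficients and exponents of
        \<open>?h\<close>.\<close>
      note D = DERIV_cmult[where c = "a j", OF DERIV_add[OF
          DERIV_mult[OF DERIV_mult[OF has_real_derivative_falling_power[where n = j, OF v] w]
              DERIV_power[where n = "k j", OF p]]
          DERIV_mult[OF DERIV_power[where n = j, OF v]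
              DERIV_cmult_right[where c = "y $ i",
                OF has_real_derivative_falling_power[where n = "k j", OF p]]]]]
      show ?thesis
        by (rule DERIV_cong[OF D])
           (simp add: algebra_simps power2_eq_square)
    qed
    then show "((\<lambda>s. ?g i (x + s *\<^sub>R ?e i)) has_real_derivative (\<Sum>j\<in>J. a j * ?h i x j)) (at 0)"
      by (intro DERIV_sum)
  qed
  have yy: "(\<Sum>i\<in>UNIV. (y $ i)\<^sup>2) = 1"
    using y by (simp add: inner_vec_def power2_eq_square)
  have xy: "(\<Sum>i\<in>UNIV. x $ i * y $ i) = p x"
    by (simp add: inner_vec_def p_def)
  have xx: "(\<Sum>i\<in>UNIV. (x $ i)\<^sup>2) = x \<bullet> x"
    by (simp add: inner_vec_def power2_eq_square)
  \<comment> \<open>The squared length of the gradient of \<open>v\<close> is again a multiple of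
    \<open>v\<close>; here \<open>c * c = c\<close> enters.\<close>
  have w2: "(\<Sum>i\<in>UNIV. (?w i x)\<^sup>2) = 4 * v x"
  proof -
    have "(\<Sum>i\<in>UNIV. (?w i x)\<^sup>2) = (\<Sum>i\<in>UNIV. 4 * (x $ i)\<^sup>2 - 8 * c * p x * (x $ i * y $ i)
        + 4 * (c * c) * (p x)\<^sup>2 * (y $ i)\<^sup>2)"
      by (intro sum.cong) (auto simp: power2_eq_square algebra_simps)
    also have "\<dots> = 4 * (x \<bullet> x) - 8 * c * p x * p x + 4 * (c * c) * (p x)\<^sup>2"
      by (simp add: sum.distrib sum_subtractf yy xy xx flip: sum_distrib_left)
    also have "\<dots> = 4 * v x"
      by (simp add: c v_def p_def power2_eq_square algebra_simps)
    finally show ?thesis .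
  qed
  \<comment> \<open>This is the inner product of the gradients of \<open>v\<close> and
    \<open>p\<close>. It vanishes for \<open>c = 1\<close>, where \<open>v\<close> is constant in
    the direction of \<open>y\<close>.\<close>
  have wy: "(\<Sum>i\<in>UNIV. ?w i x * y $ i) = 2 * (1 - c) * p x"
  proof -
    have "(\<Sum>i\<in>UNIV. ?w i x * y $ i) = (\<Sum>i\<in>UNIV. 2 * (x $ i * y $ i) - 2 * c * p x * (y $ i)\<^sup>2)"
      by (intro sum.cong) (auto simp: power2_eq_square algebra_simps)
    also have "\<dots> = 2 * (1 - c) * p x"
      unfolding sum_subtractf sum_distrib_left[symmetric] yy xy by (simp add: algebra_simps)
    finally show ?thesis .
  qed
  \<comment> \<open>The product rule for the Laplacian of \<open>v ^ j * p ^ k j\<close>: the sums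
    over coordinates are the squared gradient of \<open>v\<close>, the Laplacian of
    \<open>v\<close>, the mixed gradient product and the squared gradient of \<open>p\<close>, which
    is 1.\<close>
  have h: "(\<Sum>i\<in>UNIV. ?h i x j) = 
      real j * (4 * (real j - 1) + 2 * (real CARD('n) - c) + 4 * real (k j) * (1 - c))
        * v x ^ (j - 1) * p x ^ k j
      + real (k j) * (real (k j) - 1) * v x ^ j * p x ^ (k j - 2)" for j
  proof -
    have "(\<Sum>i\<in>UNIV. ?h i x j) = 
        real j * (real j - 1) * v x ^ (j - 2) * (\<Sum>i\<in>UNIV. (?w i x)\<^sup>2) * p x ^ k j
      + real j * v x ^ (j - 1) * (\<Sum>i\<in>UNIV. 2 - 2 * c * (y $ i)\<^sup>2) * p x ^ k j
      + 2 * (real j * v x ^ (j - 1) * (real (k j) * p x ^ (k j - 1))) * (\<Sum>i\<in>UNIV. ?w i x * y $ i)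
      + v x ^ j * (real (k j) * (real (k j) - 1) * p x ^ (k j - 2)) * (\<Sum>i\<in>UNIV. (y $ i)\<^sup>2)"
      unfolding sum.distrib by (simp only: sum_distrib_left sum_distrib_right)
    also have "(\<Sum>i\<in>UNIV. 2 - 2 * c * (y $ i)\<^sup>2) = 2 * (real CARD('n) - c)"
      by (simp add: sum_subtractf yy flip: sum_distrib_left)
    also have "real j * (real j - 1) * v x ^ (j - 2) * (\<Sum>i\<in>UNIV. (?w i x)\<^sup>2) * p x ^ k j
        = real j * 4 * (real j - 1) * v x ^ (j - 1) * p x ^ k j"
    \<comment> \<open>For \<open>j\<close> at most 1 both sides vanish through
      \<open>real j * (real j - 1)\<close>; otherwise the factor \<open>v x\<close> from
      \<open>w2\<close> raises the exponent by one.\<close>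
    proof (cases "j \<le> 1")
      case False
      then have "v x ^ (j - 1) = v x ^ (j - 2) * v x"
        by (simp flip: power_Suc2 add: Suc_diff_Suc numeral_2_eq_2)
      then show ?thesis unfolding w2 by simp
    qed (auto simp: le_Suc_eq)
    also have "2 * (real j * v x ^ (j - 1) * (real (k j) * p x ^ (k j - 1))) * (\<Sum>i\<in>UNIV. ?w i x * y $ i)
        = 4 * real j * real (k j) * (1 - c) * v x ^ (j - 1) * p x ^ k j"
      unfolding wy by (cases "k j") auto
    finally show ?thesis
      unfolding yy by (simp add: algebra_simps)
  qed
  have "laplacian ?f x = (\<Sum>i\<in>UNIV. \<Sum>j\<in>J. a j * ?h i x j)"
    unfolding laplacian_def first second ..
  also have "\<dots> = (\<Sum>j\<in>J. a j * (\<Sum>i\<in>UNIV. ?h i x j))"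
    by (subst sum.swap) (simp only: sum_distrib_left)
  finally show ?thesis unfolding h .
qed

text \<open>The Laplacian sends term \<open>j\<close> to multiples of two monomials, one with
  \<open>v\<close> lowered by a power and one with \<open>p\<close> lowered by two. Terms
  \<open>j + 1\<close> and \<open>j\<close> thus meet in \<open>v ^ j * p ^ (t - 2 * j - 2)\<close>,
  and \<open>rec\<close> says that its total coefficient is zero.\<close>

lemma zonal_in_Harm:
  fixes y :: "real ^ 'n" and c :: real and a :: "nat \<Rightarrow> real"
  assumes y: "y \<bullet> y = 1" and c: "c * c = c"
    and rec: "\<And>j. 2 * (j + 1) \<le> t \<Longrightarrow>
      a (j + 1) * (2 * (real j + 1) * (2 * real j + (real CARD('n) - c)
          + 2 * (real t - 2 * real j - 2) * (1 - c)))
        + a j * ((real t - 2 * real j) * (real t - 2 * real j - 1)) = 0"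
  shows "(\<lambda>x. \<Sum>j\<le>t div 2. a j * ((x \<bullet> x - c * (x \<bullet> y)\<^sup>2) ^ j * (x \<bullet> y) ^ (t - 2 * j))) \<in> Harm t"
    (is "?f \<in> _")
proof -
  have "homogeneous_poly 2 (\<lambda>x. x \<bullet> x + (- c) * (x \<bullet> y)\<^sup>2)"
    using homogeneous_poly_power[OF homogeneous_poly_inner, of 2 y]
    by (intro homogeneous_poly_add homogeneous_poly_inner_self homogeneous_poly_cmult) simp
  then have v: "homogeneous_poly 2 (\<lambda>x. x \<bullet> x - c * (x \<bullet> y)\<^sup>2)" by simp
  have "homogeneous_poly t (\<lambda>x. (x \<bullet> x - c * (x \<bullet> y)\<^sup>2) ^ j * (x \<bullet> y) ^ (t - 2 * j))"
    if "j \<le> t div 2" for j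
  proof -
    have "homogeneous_poly (2 * j + 1 * (t - 2 * j))
        (\<lambda>x. (x \<bullet> x - c * (x \<bullet> y)\<^sup>2) ^ j * (x \<bullet> y) ^ (t - 2 * j))"
      by (intro homogeneous_poly_mult homogeneous_poly_power v homogeneous_poly_inner)
    moreover have "2 * j + 1 * (t - 2 * j) = t" using that by simp
    ultimately show ?thesis by simp
  qed
  then have hom: "homogeneous_poly t ?f"
    by (intro homogeneous_poly_sum homogeneous_poly_cmult) simp
  have "laplacian ?f x = 0" for x
  proof -
    define N where "N = t div 2"
    define v where "v = x \<bullet> x - c * (x \<bullet> y)\<^sup>2"
    define p where "p = x \<bullet> y"
    let ?A = "\<lambda>j. a j * (real j * (4 * (real j - 1) + 2 * (real CARD('n) - c)
        + 4 * real (t - 2 * j) * (1 - c)) * v ^ (j - 1) * p ^ (t - 2 * j))"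
    let ?B = "\<lambda>j. a j * (real (t - 2 * j) * (real (t - 2 * j) - 1) * v ^ j * p ^ (t - 2 * j - 2))"
    \<comment> \<open>In the last term \<open>p\<close> has exponent 0 or 1, so its second
      derivative vanishes.\<close>
    have "t - 2 * N = 0 \<or> t - 2 * N = 1"
      unfolding N_def by linarith
    then have BN: "?B N = 0" by auto
    have "laplacian ?f x = (\<Sum>j\<le>N. ?A j + ?B j)"
      unfolding laplacian_zonal_sum[OF y c] v_def p_def N_def by (simp only: distrib_left)
    also have "\<dots> = (\<Sum>j\<le>N. ?A j) + (\<Sum>j\<le>N. ?B j)"
      by (rule sum.distrib)
    \<comment> \<open>\<open>?A 0\<close> vanishes through the factor \<open>real j\<close>; the
      shift aligns the monomials of \<open>?A\<close> with those of \<open>?B\<close>.\<close>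
    also have "(\<Sum>j\<le>N. ?A j) = (\<Sum>j<N. ?A (Suc j))"
      by (subst sum.atMost_shift) simp
    also have "(\<Sum>j\<le>N. ?B j) = (\<Sum>j<N. ?B j)"
      using BN by (simp only: lessThan_Suc_atMost[symmetric] sum.lessThan_Suc)
    also have "(\<Sum>j<N. ?A (Suc j)) + (\<Sum>j<N. ?B j) = (\<Sum>j<N. ?A (Suc j) + ?B j)"
      by (rule sum.distrib[symmetric])
    also have "\<dots> = (\<Sum>j<N. 0)"
    proof (rule sum.cong[OF refl])
      fix j assume "j \<in> {..<N}"
      then have j: "2 * (j + 1) \<le> t" unfolding N_def by auto
      then obtain d where d: "t = 2 * (j + 1) + d" using le_Suc_ex by blast
      have t: "t - 2 * Suc j = d" "t - 2 * j = Suc (Suc d)" "t - 2 * j - 2 = d"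
        "real t = 2 * real j + 2 + real d"
        using d by simp_all
      have "?A (Suc j) + ?B j = (a (j + 1) * (2 * (real j + 1) * (2 * real j + (real CARD('n) - c)
          + 2 * (real t - 2 * real j - 2) * (1 - c)))
        + a j * ((real t - 2 * real j) * (real t - 2 * real j - 1))) * (v ^ j * p ^ d)"
        unfolding t by (simp add: algebra_simps)
      then show "?A (Suc j) + ?B j = 0" unfolding rec[OF j] by simp
    qed
    finally show ?thesis by simp
  qed
  with hom show ?thesis by (simp add: Harm_def)
qed


section \<open>Gegenbauer polynomials as zonal harmonics\<close>

lemma gbinomial_Suc_mult:
  fixes a :: real
  shows "(a gchoose Suc k) * (real k + 1) = (a gchoose k) * (a - real k)"
  using gbinomial_mult_1[of a k] by (simp add: algebra_simps)

lemma binomial_Suc_mult: "real (m choose Suc k) * (real k + 1) = real (m choose k) * (real m - real k)"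
  using gbinomial_Suc_mult[of "real m" k] by (simp add: binomial_gbinomial)

text \<open>With u = r^2 - 2pr = r (r - 2p), the coefficient of r^t in u^i is read off from the
  binomial theorem. Putting i = t - j gives the classical expansion, its signs partly hidden in the
  generalised binomial coefficient.\<close>

lemma gegenbauer_explicit:
  assumes "l \<noteq> 0"
  shows "gegenbauer l t p = (\<Sum>j\<le>t div 2.
    ((- l) gchoose (t - j)) * real ((t - j) choose j) * (- 2) ^ (t - 2 * j) * p ^ (t - 2 * j))"
proof -
  let ?F = "\<lambda>j. ((- l) gchoose (t - j)) * real ((t - j) choose j)
      * (- 2) ^ (t - 2 * j) * p ^ (t - 2 * j)"
  have nth: "fps_nth ((fps_X ^ 2 - fps_const (2 * p) * fps_X) ^ i) t
      = real (i choose (t - i)) * (- 2 * p) ^ (i - (t - i))" if "i \<le> t" for i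
  proof -
    have "(fps_X ^ 2 - fps_const (2 * p) * fps_X) ^ i
        = fps_X ^ i * (fps_X + fps_const (- 2 * p)) ^ i"
      by (simp add: power2_eq_square algebra_simps flip: power_mult_distrib fps_const_neg)
    also have "fps_nth \<dots> t = fps_nth ((fps_X + fps_const (- 2 * p)) ^ i) (t - i)"
      using that by (simp add: fps_X_power_mult_nth)
    also have "\<dots> = (\<Sum>k\<le>i. real (i choose k) * (- 2 * p) ^ (i - k) * (if t - i = k then 1 else 0))"
    proof -
      have "of_nat (i choose k) * fps_X ^ k * fps_const (- 2 * p) ^ (i - k)
          = fps_const (real (i choose k) * (- 2 * p) ^ (i - k)) * fps_X ^ k" for k
      proof -
        have "fps_const (real (i choose k) * (- 2 * p) ^ (i - k))
            = fps_const (real (i choose k)) * fps_const ((- 2 * p) ^ (i - k))"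
          by (rule fps_const_mult[symmetric])
        also have "\<dots> = of_nat (i choose k) * fps_const (- 2 * p) ^ (i - k)"
          by (simp only: fps_of_nat fps_const_power)
        finally show ?thesis by (simp only: ac_simps)
      qed
      then show ?thesis
        unfolding binomial_ring fps_sum_nth by (simp only: fps_mult_left_const_nth fps_X_power_nth)
    qed
    also have "\<dots> = real (i choose (t - i)) * (- 2 * p) ^ (i - (t - i))"
      by (auto simp: if_distrib[of "\<lambda>z. _ * z"] binomial_eq_0 cong: if_cong)
    finally show ?thesis .
  qed
  have "gegenbauer l t p = (\<Sum>i\<le>t. ((- l) gchoose i)
      * (real (i choose (t - i)) * (- 2 * p) ^ (i - (t - i))))"
    using assms by (auto simp: gegenbauer_def fps_compose_nth nth atLeast0AtMost intro!: sum.cong)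
  also have "\<dots> = (\<Sum>i\<le>t. ?F (t - i))"
  proof (rule sum.cong[OF refl])
    fix i assume "i \<in> {..t}"
    then have e: "t - (t - i) = i" "t - 2 * (t - i) = i - (t - i)" by auto
    show "((- l) gchoose i) * (real (i choose (t - i)) * (- 2 * p) ^ (i - (t - i))) = ?F (t - i)"
      unfolding e power_mult_distrib by (simp only: mult.assoc)
  qed
  also have "\<dots> = (\<Sum>j\<le>t. ?F j)"
    by (rule sum.reindex_bij_witness[of _ "\<lambda>j. t - j" "\<lambda>j. t - j"]) auto
  \<comment> \<open>Beyond \<open>t div 2\<close> one has \<open>t - j < j\<close>, so the binomial
    coefficient is zero.\<close>
  also have "\<dots> = (\<Sum>j\<le>t div 2. ?F j)"
    by (rule sum.mono_neutral_right) (auto simp: binomial_eq_0)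
  finally show ?thesis .
qed

text \<open>By De Moivre, cos (t s) is the real part of (cos s + i sin s)^t. Only even powers of i
  sin s contribute, and (i sin s)^2 = -(1 - p^2) for p = cos s.\<close>

lemma gegenbauer_0_explicit:
  assumes "p \<in> {-1..1}"
  shows "gegenbauer 0 t p =
    (\<Sum>j\<le>t div 2. real (t choose (2 * j)) * (- 1) ^ j * ((1 - p\<^sup>2) ^ j * p ^ (t - 2 * j)))"
proof -
  define s where "s = arccos p"
  have cs: "cos s = p" "(sin s)\<^sup>2 = 1 - p\<^sup>2"
    using assms by (auto simp: s_def sin_squared_eq)
  let ?F = "\<lambda>k. Re (of_nat (t choose k) * (\<i> * of_real (sin s)) ^ k * of_real p ^ (t - k))"
  have odd0: "?F k = 0" if "odd k" for k
    using that by (auto elim!: oddE simp: power_mult_distrib power_mult)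
  have "gegenbauer 0 t p = Re (cis (real t * s))"
    by (simp add: gegenbauer_def s_def)
  also have "\<dots> = Re ((\<i> * of_real (sin s) + of_real p) ^ t)"
  proof -
    have "cis (real t * s) = cis s ^ t" by (rule Complex.DeMoivre[symmetric])
    also have "cis s = \<i> * of_real (sin s) + of_real p" by (simp add: complex_eq_iff cs)
    finally show ?thesis by (rule arg_cong)
  qed
  also have "\<dots> = (\<Sum>k\<le>t. ?F k)"
    unfolding binomial_ring Re_sum ..
  also have "\<dots> = (\<Sum>k\<in>(\<lambda>j. 2 * j) ` {..t div 2}. ?F k)"
  proof (rule sum.mono_neutral_right)
    show "\<forall>k\<in>{..t} - (\<lambda>j. 2 * j) ` {..t div 2}. ?F k = 0"
    proof
      fix k assume k: "k \<in> {..t} - (\<lambda>j. 2 * j) ` {..t div 2}"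
      have "odd k"
      proof
        assume "even k"
        then obtain j where "k = 2 * j" by (elim evenE)
        with k show False by auto
      qed
      then show "?F k = 0" by (rule odd0)
    qed
  qed auto
  also have "\<dots> = (\<Sum>j\<le>t div 2. ?F (2 * j))"
    by (subst sum.reindex) (auto simp: inj_on_def)
  also have "\<dots> = (\<Sum>j\<le>t div 2. real (t choose (2 * j)) * (- 1) ^ j * ((1 - p\<^sup>2) ^ j * p ^ (t - 2 * j)))"
  proof (rule sum.cong[OF refl])
    fix j
    have "(\<i> * of_real (sin s))\<^sup>2 = complex_of_real (- 1 * (sin s)\<^sup>2)"
      by (simp add: power_mult_distrib)
    then have "(\<i> * of_real (sin s)) ^ (2 * j) = complex_of_real (- 1 * (1 - p\<^sup>2)) ^ j"
      unfolding power_mult cs(2) by (rule arg_cong)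
    also have "\<dots> = complex_of_real ((- 1) ^ j * (1 - p\<^sup>2) ^ j)"
      by (simp only: of_real_power[symmetric] power_mult_distrib)
    finally have "(\<i> * of_real (sin s)) ^ (2 * j) = complex_of_real ((- 1) ^ j * (1 - p\<^sup>2) ^ j)" .
    then have "?F (2 * j) = Re (complex_of_real
        (real (t choose (2 * j)) * ((- 1) ^ j * (1 - p\<^sup>2) ^ j) * p ^ (t - 2 * j)))"
      by (simp only: of_real_mult of_real_power of_real_of_nat_eq)
    then show "?F (2 * j) = real (t choose (2 * j)) * (- 1) ^ j * ((1 - p\<^sup>2) ^ j * p ^ (t - 2 * j))"
      by (simp only: Re_complex_of_real mult.assoc)
  qed
  finally show ?thesis .
qed

text \<open>On the sphere \<open>x \<bullet> x = 1\<close>, so the explicit expansions are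
  restrictions of the polynomials of \<open>zonal_in_Harm\<close>. Dimension 2 is the Chebyshev case
  and takes \<open>c = 1\<close>; the other dimensions take \<open>c = 0\<close>.\<close>

lemma gegenbauer_zonal_harmonic:
  fixes y :: "real ^ 'n"
  assumes y: "norm y = 1"
  shows "\<exists>f\<in>Harm t. \<forall>x\<in>sphere 0 1. f x = gegenbauer ((real CARD('n) - 2) / 2) t (x \<bullet> y)"
proof (cases "CARD('n) = 2")
  case True
  define a :: "nat \<Rightarrow> real" where "a j = real (t choose (2 * j)) * (- 1) ^ j" for j
  let ?f = "\<lambda>x. \<Sum>j\<le>t div 2. a j * ((x \<bullet> x - 1 * (x \<bullet> y)\<^sup>2) ^ j * (x \<bullet> y) ^ (t - 2 * j))"
  have "?f \<in> Harm t"
  proof (rule zonal_in_Harm)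
    fix j assume j: "2 * (j + 1) \<le> t"
    \<comment> \<open>For \<open>c = 1\<close> in dimension 2 the recurrence compares the binomial
      coefficients with lower indices \<open>2 * j + 2\<close> and \<open>2 * j\<close>, so the
      ratio of neighbours is applied twice.\<close>
    have "real (t choose (2 * j + 2)) * ((2 * real j + 2) * (2 * real j + 1))
        = (real (t choose Suc (2 * j + 1)) * (real (2 * j + 1) + 1)) * (2 * real j + 1)"
      by (simp add: algebra_simps)
    also have "\<dots> = (real (t choose (2 * j + 1)) * (real t - real (2 * j + 1))) * (2 * real j + 1)"
      by (simp only: binomial_Suc_mult)
    also have "\<dots> = (real (t choose Suc (2 * j)) * (real (2 * j) + 1)) * (real t - real (2 * j + 1))"
      by (simp add: algebra_simps)
    also have "\<dots> = (real (t choose (2 * j)) * (real t - real (2 * j))) * (real t - real (2 * j + 1))"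
      by (simp only: binomial_Suc_mult)
    also have "\<dots> = real (t choose (2 * j)) * ((real t - 2 * real j) * (real t - 2 * real j - 1))"
      by (simp add: algebra_simps)
    finally have *: "real (t choose (2 * j + 2)) * ((2 * real j + 2) * (2 * real j + 1))
        = real (t choose (2 * j)) * ((real t - 2 * real j) * (real t - 2 * real j - 1))" .
    have a: "a (j + 1) = - ((- 1) ^ j * real (t choose (2 * j + 2)))"
      "a j = (- 1) ^ j * real (t choose (2 * j))"
      by (simp_all add: a_def)
    \<comment> \<open>The recurrence as a polynomial identity: \<open>e\<close> stands for the sign
      \<open>(- 1) ^ j\<close>, and the differences \<open>2 - 1\<close> and \<open>1 - 1\<close>
      stay unevaluated to match the goal.\<close>
    have key: "- (e * A) * (2 * (x + 1) * (2 * x + (2 - 1) + 2 * (y - 2 * x - 2) * (1 - 1)))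
        + e * B * ((y - 2 * x) * (y - 2 * x - 1)) = 0"
      if "A * ((2 * x + 2) * (2 * x + 1)) = B * ((y - 2 * x) * (y - 2 * x - 1))"
      for A B e x y :: real
    proof -
      have "- (e * A) * (2 * (x + 1) * (2 * x + (2 - 1) + 2 * (y - 2 * x - 2) * (1 - 1)))
          + e * B * ((y - 2 * x) * (y - 2 * x - 1))
        = e * (B * ((y - 2 * x) * (y - 2 * x - 1)) - A * ((2 * x + 2) * (2 * x + 1)))"
        by algebra
      then show ?thesis using that by simp
    qed
    show "a (j + 1) * (2 * (real j + 1) * (2 * real j + (real CARD('n) - 1)
          + 2 * (real t - 2 * real j - 2) * (1 - 1)))
        + a j * ((real t - 2 * real j) * (real t - 2 * real j - 1)) = 0"
      unfolding a True of_nat_numeral by (rule key[where e = "(- 1) ^ j", OF *])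
  qed (use y in \<open>simp_all add: norm_eq_1\<close>)
  moreover have "?f x = gegenbauer ((real CARD('n) - 2) / 2) t (x \<bullet> y)" if "x \<in> sphere 0 1" for x
  proof -
    have "\<bar>x \<bullet> y\<bar> \<le> 1"
      using Cauchy_Schwarz_ineq2[of x y] that y by simp
    then have "x \<bullet> y \<in> {-1..1}" by (simp add: abs_le_iff)
    moreover have "x \<bullet> x = 1" using that by (simp add: norm_eq_1)
    ultimately show ?thesis
      using True by (simp add: gegenbauer_0_explicit a_def)
  qed
  ultimately show ?thesis by (intro bexI[of _ ?f] ballI)
next
  case False
  define l where "l = (real CARD('n) - 2) / 2"
  have l: "l \<noteq> 0" using False by (simp add: l_def)
  have n_eq: "real CARD('n) = 2 * l + 2"
    by (simp only: l_def) (simp only: diff_add_cancel times_divide_eq_right nonzero_mult_div_cancel_left)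
  define a :: "nat \<Rightarrow> real" where
    "a j = ((- l) gchoose (t - j)) * real ((t - j) choose j) * (- 2) ^ (t - 2 * j)" for j
  let ?f = "\<lambda>x. \<Sum>j\<le>t div 2. a j * ((x \<bullet> x - 0 * (x \<bullet> y)\<^sup>2) ^ j * (x \<bullet> y) ^ (t - 2 * j))"
  have "?f \<in> Harm t"
  proof (rule zonal_in_Harm)
    fix j assume j: "2 * (j + 1) \<le> t"
    obtain d where d: "t = 2 * (j + 1) + d"
      using j le_Suc_ex by blast
    \<comment> \<open>\<open>m\<close> equals \<open>t - (j + 1)\<close>, the index occurring in
      \<open>a (j + 1)\<close>; the corresponding index in \<open>a j\<close> is
      \<open>Suc m\<close>.\<close>
    define m where "m = j + d + 1"
    have b1: "((- l) gchoose (Suc m)) * (real m + 1) = ((- l) gchoose m) * (- l - real m)"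
      by (rule gbinomial_Suc_mult)
    \<comment> \<open>Both binomial coefficients are compared with \<open>m choose j\<close>: one by
      absorption, the other by the ratio of neighbours, where \<open>m - j = d + 1\<close>.\<close>
    have b2: "real (Suc m choose j) * ((real d + 2) * (real d + 1))
        = (real m + 1) * (real j + 1) * real (m choose (j + 1))"
    proof -
      have "Suc m - j = d + 2" by (simp add: m_def)
      then have "(d + 2) * (Suc m choose j) = Suc m * (m choose j)"
        using binomial_absorb_comp[of "Suc m" j] by simp
      then have "real ((d + 2) * (Suc m choose j)) = real (Suc m * (m choose j))"
        by (rule arg_cong)
      then have "(real d + 2) * real (Suc m choose j) = (real m + 1) * real (m choose j)"
        unfolding of_nat_mult by (simp add: add.commute)
      moreover have "real (m choose (j + 1)) * (real j + 1) = real (m choose j) * (real d + 1)"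
        using binomial_Suc_mult[of m j] by (simp add: m_def)
      ultimately show ?thesis by algebra
    qed
    have tj: "t - j = Suc m" "t - (j + 1) = m" "t - 2 * j = Suc (Suc d)" "t - 2 * (j + 1) = d"
      using d by (auto simp: m_def)
    \<comment> \<open>The factor 4 splits off from \<open>(- 2) ^ (d + 2)\<close>. The chain ends at
      the recurrence for \<open>c = 0\<close>, whose bracket is \<open>2 * (l + real m)\<close>
      because the dimension is \<open>2 * l + 2\<close>.\<close>
    have "a j * ((real d + 2) * (real d + 1)) = ((- l) gchoose (Suc m)) 
       * (real (Suc m choose j) * ((real d + 2) * (real d + 1))) * 4 * (- 2) ^ d"
      unfolding a_def tj by simp
    also have "\<dots> = (((- l) gchoose (Suc m)) * (real m + 1)) * (real j + 1) * real (m choose (j + 1))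
       * 4 * (- 2) ^ d"
      unfolding b2 by simp
    also have "\<dots> = - (a (j + 1) * (2 * (real j + 1) * (2 * (l + real m))))"
      unfolding b1 a_def tj by (simp add: algebra_simps)
    finally show "a (j + 1) * (2 * (real j + 1) * (2 * real j + (real CARD('n) - 0)
          + 2 * (real t - 2 * real j - 2) * (1 - 0)))
        + a j * ((real t - 2 * real j) * (real t - 2 * real j - 1)) = 0"
      unfolding d n_eq by (simp add: m_def algebra_simps)
  qed (use y in \<open>simp_all add: norm_eq_1\<close>)
  moreover have "?f x = gegenbauer ((real CARD('n) - 2) / 2) t (x \<bullet> y)" if "x \<in> sphere 0 1" for x
  proof -
    have "x \<bullet> x = 1" using that by (simp add: norm_eq_1)
    then show ?thesis
      using l by (simp add: gegenbauer_explicit a_def flip: l_def)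
  qed
  ultimately show ?thesis by (intro bexI[of _ ?f] ballI)
qed


section \<open>The bound\<close>

text \<open>By symmetry both binomial coefficients get lower index \<open>n - 1\<close>, and the
  first has the larger upper index. For \<open>t < 2\<close> nothing is subtracted.\<close>

lemma harm_dim_pos:
  assumes "n \<ge> 2"
  shows "harm_dim n t > 0"
proof (cases "t < 2")
  case False
  obtain m where m: "n = m + 2" using assms by (metis le_add_diff_inverse2)
  obtain d where d: "t = d + 2" using False by (metis le_add_diff_inverse2 linorder_not_less)
  have "(m + d + 1) choose d = (m + d + 1) choose (m + 1)"
    by (subst binomial_symmetric) auto
  also have "\<dots> \<le> (m + d + 2) choose (m + 1)"
    by (rule binomial_right_mono) simp
  \<comment> \<open>Strict by Pascal's rule, since the additional summand is positive.\<close>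
  also have "\<dots> < (m + d + 3) choose (m + 1)"
    using choose_reduce_nat[of "m + d + 3" "m + 1"] by (simp add: numeral_3_eq_3)
  also have "\<dots> = (m + d + 3) choose (d + 2)"
    by (subst binomial_symmetric) auto
  finally have "(m + d + 1) choose d < (m + d + 3) choose (d + 2)" .
  moreover have "(m + 2) + (d + 2) - 1 = m + d + 3" "(m + 2) + (d + 2) - 3 = m + d + 1"
    "d + 2 - 2 = d" "\<not> d + 2 < 2"
    by simp_all
  ultimately show ?thesis
    unfolding harm_dim_def m d by (simp only: if_False of_nat_less_iff diff_gt_0_iff_gt)
qed (use assms in \<open>simp add: harm_dim_def\<close>)

text \<open>A minimiser has to be exhibited first, because \<open>LEAST\<close> over the reals says
  nothing unless a least element exists.\<close>

lemma Q_ge: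
  assumes "x \<in> {-1..1}"
  shows "Q n t x \<ge> - c_const n t"
proof -
  obtain z where z: "z \<in> {-1..1}" "\<forall>y\<in>{-1..1}. Q n t z \<le> Q n t y"
    using Q_attains_min by blast
  then have "(LEAST y. y \<in> Q n t ` {-1..1}) = Q n t z"
    by (intro Least_equality) auto
  then show ?thesis using z assms by (simp add: c_const_def)
qed

lemma design_sum_Q:
  fixes X :: "(real ^ 'n) set"
  assumes X: "harmonic_index_design t X" and y: "norm y = 1"
  shows "(\<Sum>x\<in>X. Q CARD('n) t (x \<bullet> y)) = 0"
proof -
  obtain f where f: "f \<in> Harm t"
    "\<forall>x\<in>sphere 0 1. f x = gegenbauer ((real CARD('n) - 2) / 2) t (x \<bullet> y)"
    using gegenbauer_zonal_harmonic[OF y] by blast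
  have "(\<Sum>x\<in>X. gegenbauer ((real CARD('n) - 2) / 2) t (x \<bullet> y)) = (\<Sum>x\<in>X. f x)"
    using X f(2) by (intro sum.cong) (auto simp: harmonic_index_design_def)
  also have "\<dots> = 0" using X f(1) by (simp add: harmonic_index_design_def)
  finally show ?thesis unfolding Q_def sum_distrib_left[symmetric] by simp
qed

theorem theorem2:
  fixes X :: "(real ^ 'n) set" and t :: nat
  assumes "CARD('n) \<ge> 2" and "t \<ge> 1"
    and "harmonic_index_design t X"
  shows "real (card X) \<ge> 1 + 1 / c_const CARD('n) t * harm_dim CARD('n) t \<and>
    (real (card X) = 1 + 1 / c_const CARD('n) t * harm_dim CARD('n) t \<longleftrightarrow>
      (\<forall>a\<in>inner_set X. c_const CARD('n) t = - Q CARD('n) t a))"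
proof -
  define c where "c = c_const CARD('n) t"
  define h where "h = harm_dim CARD('n) t"
  define q where "q = Q CARD('n) t"
  define N where "N = real (card X)"
  have X: "finite X" "X \<noteq> {}" "\<And>x. x \<in> X \<Longrightarrow> norm x = 1"
    using assms(3) by (auto simp: harmonic_index_design_def)
  have h: "h > 0" and q1: "q 1 = h"
    using assms(1) by (simp_all add: h_def q_def harm_dim_pos Q_at_1)
  have N: "N > 0" using X by (simp add: N_def card_gt_0_iff)
  have nonneg: "q (x \<bullet> y) + c \<ge> 0" if "x \<in> X" "y \<in> X" for x y
  proof -
    have "\<bar>x \<bullet> y\<bar> \<le> 1"
      using Cauchy_Schwarz_ineq2[of x y] that X by simp
    then show ?thesis using Q_ge[of "x \<bullet> y" "CARD('n)" t] by (simp add: c_def q_def abs_le_iff)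
  qed
  \<comment> \<open>All rows have the same total. One row therefore gives the bound without a double
    sum, and in the case of equality all rows vanish together.\<close>
  have row: "(\<Sum>x\<in>X - {y}. q (x \<bullet> y) + c) = (N - 1) * c - h" if "y \<in> X" for y
  proof -
    have "(\<Sum>x\<in>X. q (x \<bullet> y)) = q (y \<bullet> y) + (\<Sum>x\<in>X - {y}. q (x \<bullet> y))"
      using X(1) that by (rule sum.remove)
    moreover have "(\<Sum>x\<in>X. q (x \<bullet> y)) = 0"
      unfolding q_def using X that by (intro design_sum_Q assms) auto
    moreover have "y \<bullet> y = 1" using X that by (simp add: norm_eq_1)
    moreover have "real (card (X - {y})) = N - 1"
      using X that N by (simp add: N_def card_Diff_singleton of_nat_diff)
    ultimately show ?thesis by (simp add: sum.distrib q1)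
  qed
  obtain y0 where y0: "y0 \<in> X" using X by blast
  have "(\<Sum>x\<in>X - {y0}. q (x \<bullet> y0) + c) \<ge> 0"
    using nonneg y0 by (intro sum_nonneg) auto
  then have ineq: "(N - 1) * c \<ge> h" using row[OF y0] by simp
  have "card X \<ge> 1" using X by (simp add: Suc_leI card_gt_0_iff)
  then have "N - 1 \<ge> 0" by (simp add: N_def)
  \<comment> \<open>If \<open>c\<close> were at most 0, then \<open>(N - 1) * c\<close> would be
    too, contradicting \<open>ineq\<close> and \<open>h > 0\<close>.\<close>
  with ineq h have c: "c > 0"
    by (metis dual_order.strict_trans1 linorder_not_le mult_nonneg_nonpos)
  have bound: "N \<ge> 1 + 1 / c * h"
    using ineq c by (simp add: field_simps)
  have "N = 1 + 1 / c * h \<longleftrightarrow> (N - 1) * c - h = 0"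
    using c by (simp add: field_simps)
  \<comment> \<open>The backward direction uses the row of \<open>y0\<close>, that is, that
    \<open>X\<close> is nonempty.\<close>
  also have "\<dots> \<longleftrightarrow> (\<forall>y\<in>X. (\<Sum>x\<in>X - {y}. q (x \<bullet> y) + c) = 0)"
    using row y0 by auto
  also have "\<dots> \<longleftrightarrow> (\<forall>y\<in>X. \<forall>x\<in>X - {y}. q (x \<bullet> y) + c = 0)"
    using X(1) nonneg by (intro ball_cong refl sum_nonneg_eq_0_iff) auto
  also have "\<dots> \<longleftrightarrow> (\<forall>a\<in>inner_set X. c = - q a)"
    unfolding inner_set_def by (auto simp: eq_neg_iff_add_eq_0 add.commute)
  finally show ?thesis using bound unfolding N_def c_def h_def q_def by blast
qed

end
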